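(* Let $k\ge1$, let $n_1,\dots,n_k\ge1$, let $f_k:\{0,1\}^{n_1}\times\cdots\times\{0,1\}^{n_k}\to\{0,1\}$ be a Boolean function, and let $U_{f_k}$ be its quantum function oracle, which preserves phase information: $$U_{f_k}\sum_{x_1,\ldots,x_k,y}c_{x_1,\ldots,x_k,y}|x_1,\ldots,x_k,y\rangle=\sum_{x_1,\ldots,x_k,y}c_{x_1,\ldots,x_k,y}|x_1,\ldots,x_k,y+f_k(x_1,\ldots,x_k)\rangle$$ for all complex coefficients. Then the pair of maps induced by $U_{f_k}$ in the computational basis and in the phase basis, respectively, is given by the conjugate pair oracle $$\begin{aligned}\mathcal F_k\bigl([x_1,\chi_1],\ldots,[x_k,\chi_k],[y,\upsilon]\bigr)=\Bigl(&\bigl[x_1,\chi_1+\check f_{k,1}(\upsilon,x_2,\ldots,x_k)\bigr],\ \bigl[x_2,\chi_2+\check f_{k,2}(x_1,\upsilon,x_3,\ldots,x_k)\bigr],\ \ldots,\\ &\bigl[x_k,\chi_k+\check f_{k,k}(x_1,\ldots,x_{k-1},\upsilon)\bigr],\ \bigl[y+f_k(x_1,\ldots,x_k),\upsilon\bigr]\Bigr),\end{aligned}$$ where, for each $1\le j\le k$, $\check f_{k,j}$ is random with $$\check f_{k,j}(x_1,\ldots,x_{j-1},\upsilon,x_{j+1},\ldots,x_k)=\upsilon\, T_j(x_1,\ldots,x_{j-1},x_{j+1},\ldots,x_k),$$ $$p\bigl(T_j(x_1,\ldots,x_{j-1},x_{j+1},\ldots,x_k)=t\bigr)=\bigl|\delta_{t0}-2\widehat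 f_{k,j}(x_1,\ldots,x_{j-1},t,x_{j+1},\ldots,x_k)\bigr|^2\quad(t\in\{0,1\}^{n_j}).$$ That is: (i) if all input computational values $x_1,\ldots,x_k,y$ are well-defined, the output has well-defined computational values $x_1,\ldots,x_k,\ y+f_k(x_1,\ldots,x_k)$; (ii) for each $j$, if the computational values $x_i$ ($i\ne j$) and the phase values $\chi_j$ and $\upsilon$ of the input are well-defined, then in the output the computational values $x_i$ ($i\neq j$) and the target phase $\upsilon$ are unchanged, and reading register $j$ in the phase basis gives $\chi_j+\upsilon T_j(x_1,\ldots,x_{j-1},x_{j+1},\ldots,x_k)$ with $T_j$ distributed as stated. In particular, for $\upsilon=1$, $\check f_{k,j}$ is a Fourier sample on the $j$-th argument of $f_k$.
   Context: All bit and bitstring additions are bitwise modulo 2, and $\cdot$ is the dot product modulo 2. $\delta_{t0}$ equals 1 if $t$ is the all-zero string and 0 otherwise. $\widehat f_{k,j}$ is the Hadamard (bitwise Fourier mod 2) transform on the $j$-th argument of $f_k$, regarded as a $\{0,1\}$-valued real function: $\widehat f_{k,j}(x_1,\ldots,x_{j-1},t,x_{j+1},\ldots,x_k)=2^{-n_j}\sum_{x_j\in\{0,1\}^{n_j}}(-1)^{t\cdot x_j}f_k(x_1,\ldots,x_k)$. A Fourier sample on the $j$-th argument of $f_k$ is a sample from the squared-modulus distribution of the Hadamard transform, in the $j$-th argument, of $(-1)^{f_k}=1-2f_k$ (other arguments fixed). A conjugate pair $[x,\chi]$ of length $n$ is a pair of bitstrings of length $n$, describing an $n$-qubit register: $x$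 is the computational basis coordinate and $\chi$ the phase basis coordinate. The computational coordinate is well-defined with value $x$ when the register is in the state $|x\rangle$; the phase coordinate is well-defined with value $\chi$ when the register is in the state $H^{\otimes n}|\chi\rangle$, where $H$ is the single-qubit Hadamard gate. The two coordinates of one register are never both well-defined. Reading the computational (phase) coordinate means measuring in the basis $\{|x\rangle\}$ (respectively $\{H^{\otimes n}|\chi\rangle\}$). The control registers are $[x_j,\chi_j]$ of length $n_j$, $1\le j\le k$, and the target register is $[y,\upsilon]$ of length 1. A conjugate pair oracle formula is read as spelled out in (i) and (ii). *)

theory Defs
  imports "HOL-Probability.Probability_Mass_Function" "HOL-Library.Z2"
begin

text \<open>
  Bits are elements of the two-element field, so \<open>+\<close> and \<open>*\<close> on bits are taken modulo 2.
  Control registers are numbered \<open>0, \<dots>, k - 1\<close>; register \<open>j\<close> has length \<open>n j\<close>.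
\<close>

type_synonym bitstring = "bit list"

definition bits :: "nat \<Rightarrow> bitstring set" where
  "bits m = {v. length v = m}"

definition bs_add :: "bitstring \<Rightarrow> bitstring \<Rightarrow> bitstring" (infixl \<open>\<oplus>\<^sub>b\<close> 65) where
  "u \<oplus>\<^sub>b v = map2 (+) u v"

definition bs_scale :: "bit \<Rightarrow> bitstring \<Rightarrow> bitstring" where
  "bs_scale a v = map ((*) a) v"

definition bs_dot :: "bitstring \<Rightarrow> bitstring \<Rightarrow> bit" where
  "bs_dot u v = sum_list (map2 (*) u v)"

definition minus_one_pow :: "bit \<Rightarrow> real" where
  "minus_one_pow b = (- 1) ^ (of_bit b :: nat)"

definition tuples :: "nat \<Rightarrow> (nat \<Rightarrow> nat) \<Rightarrow> bitstring list set" where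
  "tuples k n = {xs. length xs = k \<and> (\<forall>j<k. xs ! j \<in> bits (n j))}"


section \<open>Quantum states\<close>

type_synonym label = "bitstring list \<times> bit"

text \<open>A vector of the total space is given by its coordinates in the computational basis.\<close>

type_synonym state = "label \<Rightarrow> complex"

definition basis :: "nat \<Rightarrow> (nat \<Rightarrow> nat) \<Rightarrow> label set" where
  "basis k n = tuples k n \<times> UNIV"

definition ket :: "'a \<Rightarrow> 'a \<Rightarrow> complex" where
  "ket a = (\<lambda>b. of_bool (b = a))"

definition is_state :: "nat \<Rightarrow> (nat \<Rightarrow> nat) \<Rightarrow> state \<Rightarrow> bool" where
  "is_state k n \<Psi> \<longleftrightarrow>
     (\<forall>b. b \<notin> basis k n \<longrightarrow> \<Psi> b = 0) \<and> (\<Sum>b\<in>basis k n. (cmod (\<Psi> b))\<^sup>2) = 1"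

definition hadamard_gate :: "bit \<Rightarrow> bit \<Rightarrow> complex" where
  "hadamard_gate a b = (if a = 1 \<and> b = 1 then - 1 else 1) / complex_of_real (sqrt 2)"

text \<open>The tensor power of the Hadamard gate acting on an \<open>m\<close>-qubit register.\<close>

definition hadamard_power :: "nat \<Rightarrow> (bitstring \<Rightarrow> complex) \<Rightarrow> (bitstring \<Rightarrow> complex)" where
  "hadamard_power m \<phi> = (\<lambda>v. \<Sum>w\<in>bits m. (\<Prod>i<m. hadamard_gate (v ! i) (w ! i)) * \<phi> w)"

definition phase_ket :: "bitstring \<Rightarrow> bitstring \<Rightarrow> complex" where
  "phase_ket chi = hadamard_power (length chi) (ket chi)"


section \<open>Well-defined coordinates and reading\<close>

text \<open>
  Control register \<open>j\<close> is in state \<open>\<phi>\<close> if the total state is a product of \<open>\<phi>\<close> on that register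
  with some vector \<open>\<rho>\<close> on all remaining registers (which absorbs any global phase).
\<close>

definition control_in ::
  "nat \<Rightarrow> (nat \<Rightarrow> nat) \<Rightarrow> state \<Rightarrow> nat \<Rightarrow> (bitstring \<Rightarrow> complex) \<Rightarrow> bool" where
  "control_in k n \<Psi> j \<phi> \<longleftrightarrow> is_state k n \<Psi> \<and>
     (\<exists>\<rho>. \<forall>(xs, y)\<in>basis k n. \<Psi> (xs, y) = \<phi> (xs ! j) * \<rho> (take j xs @ drop (Suc j) xs, y))"

definition target_in ::
  "nat \<Rightarrow> (nat \<Rightarrow> nat) \<Rightarrow> state \<Rightarrow> (bit \<Rightarrow> complex) \<Rightarrow> bool" where
  "target_in k n \<Psi> \<phi> \<longleftrightarrow> is_state k n \<Psi> \<and>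
     (\<exists>\<rho>. \<forall>(xs, y)\<in>basis k n. \<Psi> (xs, y) = \<rho> xs * \<phi> y)"

definition control_comp_value ::
  "nat \<Rightarrow> (nat \<Rightarrow> nat) \<Rightarrow> state \<Rightarrow> nat \<Rightarrow> bitstring \<Rightarrow> bool" where
  "control_comp_value k n \<Psi> j x \<longleftrightarrow> control_in k n \<Psi> j (ket x)"

definition control_phase_value ::
  "nat \<Rightarrow> (nat \<Rightarrow> nat) \<Rightarrow> state \<Rightarrow> nat \<Rightarrow> bitstring \<Rightarrow> bool" where
  "control_phase_value k n \<Psi> j chi \<longleftrightarrow> control_in k n \<Psi> j (phase_ket chi)"

definition target_comp_value :: "nat \<Rightarrow> (nat \<Rightarrow> nat) \<Rightarrow> state \<Rightarrow> bit \<Rightarrow> bool" where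
  "target_comp_value k n \<Psi> y \<longleftrightarrow> target_in k n \<Psi> (ket y)"

definition target_phase_value :: "nat \<Rightarrow> (nat \<Rightarrow> nat) \<Rightarrow> state \<Rightarrow> bit \<Rightarrow> bool" where
  "target_phase_value k n \<Psi> \<upsilon> \<longleftrightarrow> target_in k n \<Psi> (\<lambda>y. phase_ket [\<upsilon>] [y])"

text \<open>The projector onto \<open>\<phi>\<close> on control register \<open>j\<close>, tensored with the identity elsewhere.\<close>

definition control_project ::
  "(nat \<Rightarrow> nat) \<Rightarrow> nat \<Rightarrow> (bitstring \<Rightarrow> complex) \<Rightarrow> state \<Rightarrow> state" where
  "control_project n j \<phi> \<Psi> =
     (\<lambda>(xs, y). \<phi> (xs ! j) * (\<Sum>v\<in>bits (n j). cnj (\<phi> v) * \<Psi> (xs[j := v], y)))"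

text \<open>Born probability of outcome \<open>\<omega>\<close> when control register \<open>j\<close> is read in the phase basis.\<close>

definition read_phase_prob ::
  "nat \<Rightarrow> (nat \<Rightarrow> nat) \<Rightarrow> state \<Rightarrow> nat \<Rightarrow> bitstring \<Rightarrow> real" where
  "read_phase_prob k n \<Psi> j \<omega> =
     (\<Sum>b\<in>basis k n. (cmod (control_project n j (phase_ket \<omega>) \<Psi> b))\<^sup>2)"


section \<open>Hadamard transform in one argument and Fourier samples\<close>

text \<open>As in the usual notation, the \<open>j\<close>-th argument \<open>xs ! j\<close> of the transform is the frequency.\<close>

definition hadamard_transform ::
  "(nat \<Rightarrow> nat) \<Rightarrow> nat \<Rightarrow> (bitstring list \<Rightarrow> real) \<Rightarrow> bitstring list \<Rightarrow> real" where
  "hadamard_transform n j g xs =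
     (\<Sum>x\<in>bits (n j). minus_one_pow (bs_dot (xs ! j) x) * g (xs[j := x])) / 2 ^ n j"

definition f_hat ::
  "(nat \<Rightarrow> nat) \<Rightarrow> (bitstring list \<Rightarrow> bit) \<Rightarrow> nat \<Rightarrow> bitstring list \<Rightarrow> real" where
  "f_hat n f j = hadamard_transform n j (\<lambda>xs. of_bit (f xs))"

definition T_prob ::
  "(nat \<Rightarrow> nat) \<Rightarrow> (bitstring list \<Rightarrow> bit) \<Rightarrow> nat \<Rightarrow> bitstring list \<Rightarrow> bitstring \<Rightarrow> real" where
  "T_prob n f j xs t = \<bar>of_bool (t = replicate (n j) 0) - 2 * f_hat n f j (xs[j := t])\<bar>\<^sup>2"

definition fourier_sample_prob ::
  "(nat \<Rightarrow> nat) \<Rightarrow> (bitstring list \<Rightarrow> bit) \<Rightarrow> nat \<Rightarrow> bitstring list \<Rightarrow> bitstring \<Rightarrow> real" where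
  "fourier_sample_prob n f j xs t =
     \<bar>hadamard_transform n j (\<lambda>xs. minus_one_pow (f xs)) (xs[j := t])\<bar>\<^sup>2"

text \<open>
  The distribution of the random string \<open>T\<^sub>j\<close>; the entry \<open>xs ! j\<close> is overwritten and hence ignored.
  Since \<^const>\<open>embed_pmf\<close> is only meaningful for a function with total mass 1, that the
  probabilities are the intended ones is something to be proved.
\<close>

definition T_dist ::
  "(nat \<Rightarrow> nat) \<Rightarrow> (bitstring list \<Rightarrow> bit) \<Rightarrow> nat \<Rightarrow> bitstring list \<Rightarrow> bitstring pmf" where
  "T_dist n f j xs = embed_pmf (\<lambda>t. if t \<in> bits (n j) then T_prob n f j xs t else 0)"

definition f_check ::
  "(nat \<Rightarrow> nat) \<Rightarrow> (bitstring list \<Rightarrow> bit) \<Rightarrow> nat \<Rightarrow> bit \<Rightarrow> bitstring list \<Rightarrow> bitstring pmf" where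
  "f_check n f j \<upsilon> xs = map_pmf (bs_scale \<upsilon>) (T_dist n f j xs)"


section \<open>Conjugate pair oracles\<close>

text \<open>
  The input consists of the control pairs \<open>[x, chi]\<close> and the target pair \<open>[y, \<upsilon>]\<close>. In the output
  each control phase coordinate is random; only its own distribution is recorded, since the phase
  coordinates of different control registers are never read together.
\<close>

type_synonym conjugate_pair_oracle =
  "(bitstring \<times> bitstring) list \<Rightarrow> bit \<times> bit \<Rightarrow> (bitstring \<times> bitstring pmf) list \<times> (bit \<times> bit)"

definition function_cp_oracle ::
  "nat \<Rightarrow> (nat \<Rightarrow> nat) \<Rightarrow> (bitstring list \<Rightarrow> bit) \<Rightarrow> conjugate_pair_oracle" where
  "function_cp_oracle k n f = (\<lambda>ps (y, \<upsilon>).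
     let xs = map fst ps; chis = map snd ps in
       (map (\<lambda>j. (xs ! j, map_pmf (\<lambda>d. chis ! j \<oplus>\<^sub>b d) (f_check n f j \<upsilon> xs))) [0..<k],
        (y + f xs, \<upsilon>)))"

text \<open>
  How an oracle formula \<open>F\<close> is read as a statement about a map \<open>U\<close> on states. In the second
  part, those coordinates of the input of \<open>F\<close> that are not well-defined in \<open>\<Psi>\<close> are arbitrary.
\<close>

definition induces_cp_oracle ::
  "nat \<Rightarrow> (nat \<Rightarrow> nat) \<Rightarrow> (state \<Rightarrow> state) \<Rightarrow> conjugate_pair_oracle \<Rightarrow> bool" where
  "induces_cp_oracle k n U F \<longleftrightarrow>
     (\<forall>ps y \<upsilon> qs y' \<upsilon>' \<Psi>.
        map fst ps \<in> tuples k n \<and> map snd ps \<in> tuples k n \<and>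
        F ps (y, \<upsilon>) = (qs, (y', \<upsilon>')) \<and> is_state k n \<Psi> \<longrightarrow>
        ((\<forall>i<k. control_comp_value k n \<Psi> i (fst (ps ! i))) \<and> target_comp_value k n \<Psi> y \<longrightarrow>
           (\<forall>i<k. control_comp_value k n (U \<Psi>) i (fst (qs ! i))) \<and>
           target_comp_value k n (U \<Psi>) y') \<and>
        (\<forall>j<k.
           (\<forall>i<k. i \<noteq> j \<longrightarrow> control_comp_value k n \<Psi> i (fst (ps ! i))) \<and>
           control_phase_value k n \<Psi> j (snd (ps ! j)) \<and> target_phase_value k n \<Psi> \<upsilon> \<longrightarrow>
           (\<forall>i<k. i \<noteq> j \<longrightarrow> control_comp_value k n (U \<Psi>) i (fst (qs ! i))) \<and>
           target_phase_value k n (U \<Psi>) \<upsilon>' \<and>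
           (\<forall>\<omega>\<in>bits (n j). read_phase_prob k n (U \<Psi>) j \<omega> = pmf (snd (qs ! j)) \<omega>)))"

end

theory Submission
  imports Defs
begin

text \<open>
  If all computational values are well-defined, the state is a multiple of one basis vector, which
  \<open>U\<close> maps to a basis vector. For the phase part, the state is
  supported on the slice where only the \<open>j\<close>-th control varies, and there it equals
  \<open>\<gamma> (-1)\<^bsup>chi \<cdot> v + \<upsilon> y\<^esup>\<close>. Replacing \<open>y\<close> by \<open>y + f\<close> multiplies this by the phase
  \<open>(-1)\<^bsup>\<upsilon> f\<^esup>\<close>, so the target phase is kicked back into register \<open>j\<close>, and the amplitude of
  \<open>\<omega>\<close> in the phase basis is the Hadamard transform of \<open>(-1)\<^bsup>\<upsilon> f\<^esup>\<close> at \<open>chi + \<omega>\<close>. For \<open>\<upsilon> = 0\<close>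
  this is a point mass, for \<open>\<upsilon> = 1\<close> a Fourier sample; Parseval's identity shows that the latter
  is a probability distribution.
\<close>

text \<open>By default the simplifier turns \<open>+\<close> and \<open>*\<close> on bits into bitwise operations, hiding the ring structure.\<close>

declare add_bit_eq_xor [simp del] mult_bit_eq_and [simp del]

section \<open>Characters of bitstrings\<close>

lemma UNIV_bit: "(UNIV :: bit set) = {0, 1}"
  using bit.exhaust by auto

lemma bit_add_cancel [simp]: "a + b + b = (a :: bit)"
  by (simp add: add.assoc)

lemma minus_one_pow_0 [simp]: "minus_one_pow 0 = 1"
  and minus_one_pow_1 [simp]: "minus_one_pow 1 = - 1"
  by (simp_all add: minus_one_pow_def)

lemma minus_one_pow_add: "minus_one_pow (a + b) = minus_one_pow a * minus_one_pow b"
  by (cases a; cases b) simp_all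

lemma minus_one_pow_square [simp]: "(minus_one_pow a)\<^sup>2 = 1"
  by (cases a) simp_all

lemma minus_one_pow_nonzero [simp]: "minus_one_pow a \<noteq> 0"
  by (cases a) simp_all

lemma minus_one_pow_eq: "minus_one_pow a = 1 - 2 * of_bit a"
  by (cases a) simp_all

section \<open>Strings of fixed length\<close>

lemma in_bits_iff: "v \<in> bits m \<longleftrightarrow> length v = m"
  by (simp add: bits_def)

lemma bits_0 [simp]: "bits 0 = {[]}"
  by (auto simp: in_bits_iff)

lemma bits_Suc: "bits (Suc m) = (#) 0 ` bits m \<union> (#) 1 ` bits m"
proof (intro equalityI subsetI)
  fix v assume "v \<in> bits (Suc m)"
  then obtain a w where "v = a # w" "w \<in> bits m"
    by (auto simp: in_bits_iff length_Suc_conv)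
  then show "v \<in> (#) 0 ` bits m \<union> (#) 1 ` bits m"
    by (cases a) auto
qed (auto simp: in_bits_iff)

lemma finite_bits [simp]: "finite (bits m)"
  by (induction m) (simp_all add: bits_Suc)

lemma sum_bits_Suc:
  fixes g :: "bitstring \<Rightarrow> 'a::comm_monoid_add"
  shows "sum g (bits (Suc m)) = (\<Sum>v\<in>bits m. g (0 # v)) + (\<Sum>v\<in>bits m. g (1 # v))"
  unfolding bits_Suc by (subst sum.union_disjoint) (auto simp: sum.reindex)

lemma card_bits: "card (bits m) = 2 ^ m"
proof (induction m)
  case (Suc m)
  then show ?case
    using sum_bits_Suc[of "\<lambda>_. 1 :: nat" m] by simp
qed simp

lemma replicate_in_bits [simp]: "replicate m a \<in> bits m"
  by (simp add: in_bits_iff)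

section \<open>Dot product and bitwise addition\<close>

lemma bs_dot_Nil [simp]: "bs_dot [] v = 0"
  by (simp add: bs_dot_def)

lemma bs_dot_Cons [simp]: "bs_dot (a # u) (b # v) = a * b + bs_dot u v"
  by (simp add: bs_dot_def)

lemma bs_dot_commute: "bs_dot u v = bs_dot v u"
  by (induction u v rule: list_induct2') (simp_all add: bs_dot_def mult.commute)

lemma bs_add_Nil [simp]: "[] \<oplus>\<^sub>b v = []"
  by (simp add: bs_add_def)

lemma bs_add_Cons [simp]: "(a # u) \<oplus>\<^sub>b (b # v) = (a + b) # (u \<oplus>\<^sub>b v)"
  by (simp add: bs_add_def)

lemma length_bs_add [simp]: "length (u \<oplus>\<^sub>b v) = min (length u) (length v)"
  by (simp add: bs_add_def)

lemma bs_add_in_bits: "u \<in> bits m \<Longrightarrow> v \<in> bits m \<Longrightarrow> u \<oplus>\<^sub>b v \<in> bits m"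
  by (simp add: in_bits_iff)

lemma bs_add_cancel: "length u = length v \<Longrightarrow> u \<oplus>\<^sub>b (u \<oplus>\<^sub>b v) = v"
  by (induction u v rule: list_induct2) (simp_all flip: add.assoc)

lemma bs_add_replicate_0: "u \<oplus>\<^sub>b replicate (length u) 0 = u"
  by (induction u) simp_all

lemma bs_add_eq_0_iff: "length u = length v \<Longrightarrow> u \<oplus>\<^sub>b v = replicate (length v) 0 \<longleftrightarrow> u = v"
proof (induction u v rule: list_induct2)
  case (Cons a u b v)
  then show ?case by (cases a; cases b) simp_all
qed simp

lemma bs_dot_add_left:
  assumes "length u = length w" "length w = length v"
  shows "bs_dot (u \<oplus>\<^sub>b w) v = bs_dot u v + bs_dot w v"
  using assms by (induction u w v rule: list_induct3) (simp_all add: algebra_simps)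

text \<open>Orthogonality of characters, by splitting off the first bit: a frequency bit 0 doubles
  the sum, a frequency bit 1 makes the two halves cancel.\<close>

lemma sum_minus_one_pow_bs_dot:
  assumes "t \<in> bits m"
  shows "(\<Sum>x\<in>bits m. minus_one_pow (bs_dot t x)) = of_bool (t = replicate m 0) * 2 ^ m"
  using assms
proof (induction m arbitrary: t)
  case (Suc m)
  then obtain a s where t: "t = a # s" and s: "s \<in> bits m"
    by (auto simp: bits_Suc)
  show ?case
    using Suc.IH[OF s]
    by (cases a) (simp_all add: t sum_bits_Suc minus_one_pow_add sum_negf)
qed simp

text \<open>Expanding the square and summing over the frequency first leaves only the diagonal
  \<open>x = y\<close>, by orthogonality. The version for \<open>(g x)\<^sup>2 = 1\<close> suffices,
  since it is applied to signs.\<close>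

lemma parseval:
  assumes "\<And>x. x \<in> bits m \<Longrightarrow> (g x)\<^sup>2 = 1"
  shows "(\<Sum>t\<in>bits m. ((\<Sum>x\<in>bits m. minus_one_pow (bs_dot t x) * g x) / 2 ^ m)\<^sup>2) = 1"
proof -
  have "(\<Sum>t\<in>bits m. (\<Sum>x\<in>bits m. minus_one_pow (bs_dot t x) * g x)\<^sup>2)
      = (\<Sum>t\<in>bits m. \<Sum>x\<in>bits m. \<Sum>y\<in>bits m. minus_one_pow (bs_dot (x \<oplus>\<^sub>b y) t) * (g x * g y))"
    unfolding power2_eq_square sum_product
  proof (intro sum.cong refl)
    fix t x y assume "t \<in> bits m" "x \<in> bits m" "y \<in> bits m"
    then show "minus_one_pow (bs_dot t x) * g x * (minus_one_pow (bs_dot t y) * g y)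
        = minus_one_pow (bs_dot (x \<oplus>\<^sub>b y) t) * (g x * g y)"
      by (simp add: in_bits_iff bs_dot_add_left minus_one_pow_add bs_dot_commute[of t])
  qed
  also have "\<dots> = (\<Sum>x\<in>bits m. \<Sum>y\<in>bits m. \<Sum>t\<in>bits m.
      minus_one_pow (bs_dot (x \<oplus>\<^sub>b y) t) * (g x * g y))"
    by (subst sum.swap) (intro sum.cong refl sum.swap)
  also have "\<dots> = (\<Sum>x\<in>bits m. \<Sum>y\<in>bits m. of_bool (x = y) * 2 ^ m * (g x * g y))"
  proof (intro sum.cong refl)
    fix x y assume "x \<in> bits m" "y \<in> bits m"
    then show "(\<Sum>t\<in>bits m. minus_one_pow (bs_dot (x \<oplus>\<^sub>b y) t) * (g x * g y))
        = of_bool (x = y) * 2 ^ m * (g x * g y)"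
      using bs_add_eq_0_iff[of x y]
      by (simp add: sum_minus_one_pow_bs_dot bs_add_in_bits in_bits_iff flip: sum_distrib_right)
  qed
  also have "\<dots> = (\<Sum>x\<in>bits m. 2 ^ m * (g x)\<^sup>2)"
  proof (intro sum.cong refl)
    fix x assume "x \<in> bits m"
    then have "(\<Sum>y\<in>bits m. of_bool (x = y) * 2 ^ m * (g x * g y))
        = (\<Sum>y\<in>bits m. if y = x then 2 ^ m * (g x)\<^sup>2 else 0)"
      by (intro sum.cong) (auto simp: power2_eq_square)
    with \<open>x \<in> bits m\<close> show "(\<Sum>y\<in>bits m. of_bool (x = y) * 2 ^ m * (g x * g y)) = 2 ^ m * (g x)\<^sup>2"
      by simp
  qed
  also have "\<dots> = 2 ^ m * 2 ^ m"
    using assms by (simp add: card_bits)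
  finally show ?thesis
    by (simp add: power_divide power2_eq_square flip: sum_divide_distrib)
qed

text \<open>The ket collapses the sum over \<open>w\<close>, and each qubit contributes the gate
  entry \<open>minus_one_pow (a * b) / sqrt 2\<close>; signs multiply to the dot product.\<close>

lemma phase_ket_eq:
  assumes "length v = length chi"
  shows "phase_ket chi v = of_real (minus_one_pow (bs_dot chi v) / sqrt 2 ^ length chi)"
proof -
  have "phase_ket chi v =
      (\<Sum>w\<in>bits (length chi). if w = chi then \<Prod>i<length chi. hadamard_gate (v ! i) (w ! i) else 0)"
    by (auto simp: phase_ket_def hadamard_power_def ket_def intro!: sum.cong)
  also have "\<dots> = (\<Prod>i<length chi. hadamard_gate (v ! i) (chi ! i))"
    by (subst sum.delta) (simp, simp add: in_bits_iff)
  also have "\<dots> = of_real (minus_one_pow (bs_dot v chi) / sqrt 2 ^ length chi)"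
    using assms
  proof (induction v chi rule: list_induct2)
    case (Cons a v b chi)
    have "hadamard_gate a b = of_real (minus_one_pow (a * b) / sqrt 2)"
      by (cases a; cases b) (simp_all add: hadamard_gate_def)
    with Cons show ?case
      by (simp add: prod.lessThan_Suc_shift minus_one_pow_add del: prod.lessThan_Suc)
  qed simp
  finally show ?thesis
    by (simp add: bs_dot_commute)
qed

lemma phase_ket_bit:
  "phase_ket [a] [b] = of_real (minus_one_pow (a * b) / sqrt 2)"
  by (simp add: phase_ket_eq)

section \<open>Fourier samples\<close>

lemma hadamard_transform_update:
  assumes "j < length xs"
  shows "hadamard_transform n j g (xs[j := t])
    = (\<Sum>x\<in>bits (n j). minus_one_pow (bs_dot t x) * g (xs[j := x])) / 2 ^ n j"
  using assms by (simp add: hadamard_transform_def)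

text \<open>Since the sign is \<open>1 - 2 * f\<close> and the transform of the constant 1 is the
  delta at the zero string, the two expressions agree by linearity.\<close>

lemma T_prob_eq_fourier_sample_prob:
  assumes "j < length xs" "t \<in> bits (n j)"
  shows "T_prob n f j xs t = fourier_sample_prob n f j xs t"
proof -
  have "hadamard_transform n j (\<lambda>xs. minus_one_pow (f xs)) (xs[j := t])
      = (\<Sum>x\<in>bits (n j). minus_one_pow (bs_dot t x)) / 2 ^ n j - 2 * f_hat n f j (xs[j := t])"
    using assms(1)
    by (simp add: hadamard_transform_update f_hat_def minus_one_pow_eq[of "f _"] right_diff_distrib
        sum_subtractf diff_divide_distrib sum_distrib_left mult_ac
        del: sum_mult_of_bool_eq sum_of_bool_mult_eq)
  then show ?thesis
    using assms(2) by (simp add: T_prob_def fourier_sample_prob_def sum_minus_one_pow_bs_dot)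
qed

text \<open>This justifies the use of \<open>embed_pmf\<close>: Parseval, applied to the signs of
  \<open>f\<close> as its \<open>j\<close>-th argument varies, gives total mass 1.\<close>

lemma pmf_T_dist:
  assumes "j < length xs"
  shows "pmf (T_dist n f j xs) t = (if t \<in> bits (n j) then fourier_sample_prob n f j xs t else 0)"
proof -
  let ?p = "\<lambda>t. if t \<in> bits (n j) then T_prob n f j xs t else 0"
  have p: "0 \<le> ?p t" for t
    by (simp add: T_prob_def)
  have "(\<integral>\<^sup>+t. ennreal (?p t) \<partial>count_space UNIV) = (\<Sum>t\<in>bits (n j). ennreal (?p t))"
    by (subst nn_integral_count_space'[of "bits (n j)"]) auto
  also have "\<dots> = ennreal (\<Sum>t\<in>bits (n j). fourier_sample_prob n f j xs t)"
    using assms by (subst sum_ennreal) (auto simp: T_prob_eq_fourier_sample_prob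
        fourier_sample_prob_def intro!: arg_cong[of _ _ ennreal] sum.cong)
  also have "\<dots> = 1"
    using assms parseval[of "n j" "\<lambda>x. minus_one_pow (f (xs[j := x]))"]
    by (simp add: fourier_sample_prob_def hadamard_transform_update power_divide)
  finally have "pmf (T_dist n f j xs) t = ?p t"
    unfolding T_dist_def by (rule pmf_embed_pmf[OF p])
  with assms show ?thesis
    by (simp add: T_prob_eq_fourier_sample_prob)
qed

lemma set_pmf_T_dist: "j < length xs \<Longrightarrow> set_pmf (T_dist n f j xs) \<subseteq> bits (n j)"
  by (auto simp: set_pmf_iff pmf_T_dist split: if_splits)

section \<open>Scaling the sample by the target phase\<close>

lemma bs_scale_1 [simp]: "bs_scale 1 = id"
  by (auto simp: fun_eq_iff bs_scale_def intro: map_idI)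

lemma bs_scale_0 [simp]: "bs_scale 0 v = replicate (length v) 0"
  by (induction v) (simp_all add: bs_scale_def)

lemma f_check_1: "f_check n f j 1 xs = T_dist n f j xs"
  by (simp add: f_check_def map_pmf_id)

text \<open>Scaling by 0 keeps the length of a string, so the support bound on \<open>T_dist\<close>
  is what makes the result one fixed zero string.\<close>

lemma f_check_0:
  assumes "j < length xs"
  shows "f_check n f j 0 xs = return_pmf (replicate (n j) 0)"
proof -
  have "f_check n f j 0 xs = map_pmf (\<lambda>_. replicate (n j) 0) (T_dist n f j xs)"
    unfolding f_check_def using set_pmf_T_dist[OF assms, of n f]
    by (intro map_pmf_cong) (auto simp: in_bits_iff)
  then show ?thesis
    by simp
qed

text \<open>Covers both target phases by one closed form, to be matched with the Born probability of
  reading register \<open>j\<close>.\<close>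

lemma pmf_shifted_f_check:
  assumes j: "j < length xs" and chi: "chi \<in> bits (n j)" and \<omega>: "\<omega> \<in> bits (n j)"
  shows "pmf (map_pmf (\<lambda>d. chi \<oplus>\<^sub>b d) (f_check n f j \<upsilon> xs)) \<omega>
    = ((\<Sum>v\<in>bits (n j). minus_one_pow (bs_dot (chi \<oplus>\<^sub>b \<omega>) v) * minus_one_pow (\<upsilon> * f (xs[j := v])))
        / 2 ^ n j)\<^sup>2"
proof (cases "\<upsilon> = 0")
  case True
  \<comment> \<open>With trivial signs the right-hand sum is a delta by orthogonality; squaring does
    not change a 0/1 value.\<close>
  have "pmf (return_pmf chi) \<omega> = (of_bool (chi \<oplus>\<^sub>b \<omega> = replicate (n j) 0))\<^sup>2"
    using bs_add_eq_0_iff[of chi \<omega>] chi \<omega> by (auto simp: in_bits_iff indicator_def)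
  with True chi bs_add_replicate_0[of chi] show ?thesis
    by (simp add: f_check_0[OF j] sum_minus_one_pow_bs_dot[OF bs_add_in_bits[OF chi \<omega>]] in_bits_iff)
next
  case False
  then have \<upsilon>: "\<upsilon> = 1" by simp
  let ?T = "T_dist n f j xs"
  have inv: "chi \<oplus>\<^sub>b (chi \<oplus>\<^sub>b d) = d" if "d \<in> bits (n j)" for d
    using chi that by (simp add: bs_add_cancel in_bits_iff)
  have T: "set_pmf ?T \<subseteq> bits (n j)"
    by (rule set_pmf_T_dist[OF j])
  \<comment> \<open>Adding \<open>chi\<close> is an involution on strings of length
    \<open>n j\<close>, so the shift can be undone. Outside the support both sides are 0.\<close>
  have "pmf (map_pmf (\<lambda>d. chi \<oplus>\<^sub>b d) ?T) \<omega> = pmf ?T (chi \<oplus>\<^sub>b \<omega>)"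
  proof (cases "chi \<oplus>\<^sub>b \<omega> \<in> set_pmf ?T")
    case True
    \<comment> \<open>Injectivity holds only on strings of the right length, because the addition
      truncates longer ones.\<close>
    have "inj_on (\<lambda>d. chi \<oplus>\<^sub>b d) (set_pmf ?T)"
      by (rule inj_on_inverseI[of _ "\<lambda>d. chi \<oplus>\<^sub>b d"]) (use T inv in auto)
    from pmf_map_inj[OF this True] show ?thesis
      by (simp add: inv[OF \<omega>])
  next
    case False
    then have "\<omega> \<notin> (\<lambda>d. chi \<oplus>\<^sub>b d) ` set_pmf ?T"
      using T inv by auto
    with False show ?thesis
      by (simp add: pmf_map_outside set_pmf_iff)
  qed
  with \<upsilon> j show ?thesis
    by (simp add: f_check_1 pmf_T_dist bs_add_in_bits[OF chi \<omega>] fourier_sample_prob_def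
        hadamard_transform_update power_divide)
qed

section \<open>States\<close>

lemma finite_tuples [simp]: "finite (tuples k n)"
proof -
  have "tuples k n \<subseteq> {xs. set xs \<subseteq> (\<Union>j<k. bits (n j)) \<and> length xs = k}"
    by (force simp: tuples_def in_set_conv_nth)
  then show ?thesis
    by (rule finite_subset) (intro finite_lists_length_eq finite_UN_I, auto)
qed

lemma finite_basis [simp]: "finite (basis k n)"
  by (simp add: basis_def UNIV_bit)

lemma mem_basis [simp]: "(xs, y) \<in> basis k n \<longleftrightarrow> xs \<in> tuples k n"
  by (simp add: basis_def)

lemma tuples_update: "xs \<in> tuples k n \<Longrightarrow> v \<in> bits (n j) \<Longrightarrow> xs[j := v] \<in> tuples k n"
  by (cases "j < k") (auto simp: tuples_def nth_list_update)

text \<open>A label with nonzero contribution agrees with \<open>x\<close> off \<open>j\<close>,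
  hence is an update of \<open>x\<close> at \<open>j\<close>. This serves both the normalisation of
  a state and the Born probability.\<close>

lemma sum_basis_slice:
  fixes g :: "label \<Rightarrow> real"
  assumes x: "x \<in> tuples k n" and j: "j < k"
    and zero: "\<And>xs y i. xs \<in> tuples k n \<Longrightarrow> i < k \<Longrightarrow> i \<noteq> j \<Longrightarrow> xs ! i \<noteq> x ! i \<Longrightarrow> g (xs, y) = 0"
  shows "sum g (basis k n) = (\<Sum>v\<in>bits (n j). \<Sum>y\<in>UNIV. g (x[j := v], y))"
proof -
  let ?S = "(\<lambda>(v, y). (x[j := v], y)) ` (bits (n j) \<times> (UNIV :: bit set))"
  have len: "length x = k"
    using x by (simp add: tuples_def)
  have "sum g (basis k n) = sum g ?S"
  proof (rule sum.mono_neutral_right)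
    show "?S \<subseteq> basis k n"
      using x by (auto intro: tuples_update)
    show "\<forall>b\<in>basis k n - ?S. g b = 0"
    proof
      fix b assume b: "b \<in> basis k n - ?S"
      obtain xs y where xs: "b = (xs, y)" by (cases b)
      show "g b = 0"
      proof (rule ccontr)
        assume "g b \<noteq> 0"
        with b xs zero have "xs ! i = x ! i" if "i < k" "i \<noteq> j" for i
          using that by auto
        moreover have "length xs = k" "xs ! j \<in> bits (n j)"
          using b xs j by (auto simp: tuples_def)
        ultimately have "xs = x[j := xs ! j]"
          using len j by (simp add: list_eq_iff_nth_eq nth_list_update)
        with b xs \<open>xs ! j \<in> bits (n j)\<close> show False
          by force
      qed
    qed
  qed simp
  also have "\<dots> = (\<Sum>(v, y)\<in>bits (n j) \<times> UNIV. g (x[j := v], y))"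
  proof (subst sum.reindex)
    \<comment> \<open>The string \<open>v\<close> is recovered as entry \<open>j\<close> of the
      updated list.\<close>
    show "inj_on (\<lambda>(v, y). (x[j := v], y)) (bits (n j) \<times> (UNIV :: bit set))"
      using len j by (auto simp: inj_on_def dest: arg_cong[of _ _ "\<lambda>l. l ! j"])
  qed (simp add: case_prod_beta comp_def)
  finally show ?thesis
    by (simp add: sum.cartesian_product)
qed

text \<open>Replaces the existential product form by a vanishing condition, which is easy to carry
  through the oracle.\<close>

lemma control_comp_value_iff:
  assumes "j < k"
  shows "control_comp_value k n \<Psi> j x \<longleftrightarrow>
    is_state k n \<Psi> \<and> (\<forall>xs\<in>tuples k n. \<forall>y. xs ! j \<noteq> x \<longrightarrow> \<Psi> (xs, y) = 0)"
proof
  assume "control_comp_value k n \<Psi> j x"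
  then show "is_state k n \<Psi> \<and> (\<forall>xs\<in>tuples k n. \<forall>y. xs ! j \<noteq> x \<longrightarrow> \<Psi> (xs, y) = 0)"
    by (auto simp: control_comp_value_def control_in_def ket_def basis_def)
next
  assume \<Psi>: "is_state k n \<Psi> \<and> (\<forall>xs\<in>tuples k n. \<forall>y. xs ! j \<noteq> x \<longrightarrow> \<Psi> (xs, y) = 0)"
  \<comment> \<open>The argument \<open>zs\<close> lacks register \<open>j\<close>; the witness puts
    \<open>x\<close> back in its place.\<close>
  define \<rho> where "\<rho> = (\<lambda>(zs, y). \<Psi> (take j zs @ x # drop j zs, y))"
  have "\<Psi> (xs, y) = ket x (xs ! j) * \<rho> (take j xs @ drop (Suc j) xs, y)" if "xs \<in> tuples k n" for xs y
  proof (cases "xs ! j = x")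
    case True
    have "j < length xs"
      using that assms by (simp add: tuples_def)
    with True have "take j xs @ x # drop (Suc j) xs = xs"
      using id_take_nth_drop by metis
    with True \<open>j < length xs\<close> show ?thesis
      by (simp add: \<rho>_def ket_def)
  qed (use \<Psi> that in \<open>simp add: ket_def\<close>)
  with \<Psi> show "control_comp_value k n \<Psi> j x"
    unfolding control_comp_value_def control_in_def by (auto intro!: exI[of _ \<rho>])
qed

lemma target_comp_value_iff:
  "target_comp_value k n \<Psi> y \<longleftrightarrow>
    is_state k n \<Psi> \<and> (\<forall>xs\<in>tuples k n. \<forall>y'. y' \<noteq> y \<longrightarrow> \<Psi> (xs, y') = 0)"
proof
  assume "target_comp_value k n \<Psi> y"
  then show "is_state k n \<Psi> \<and> (\<forall>xs\<in>tuples k n. \<forall>y'. y' \<noteq> y \<longrightarrow> \<Psi> (xs, y') = 0)"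
    by (auto simp: target_comp_value_def target_in_def ket_def basis_def)
next
  assume "is_state k n \<Psi> \<and> (\<forall>xs\<in>tuples k n. \<forall>y'. y' \<noteq> y \<longrightarrow> \<Psi> (xs, y') = 0)"
  then show "target_comp_value k n \<Psi> y"
    unfolding target_comp_value_def target_in_def
    by (auto simp: ket_def intro!: exI[of _ "\<lambda>xs. \<Psi> (xs, y)"])
qed

section \<open>The action of the oracle\<close>

text \<open>The oracle acting on amplitudes by pullback. The inverse of adding \<open>f xs\<close>
  is adding it again, so the same sign-free formula appears.\<close>

definition oracle_map :: "(bitstring list \<Rightarrow> bit) \<Rightarrow> state \<Rightarrow> state" where
  "oracle_map f \<Psi> = (\<lambda>(xs, y). \<Psi> (xs, y + f xs))"

lemma oracle_map_apply [simp]: "oracle_map f \<Psi> (xs, y) = \<Psi> (xs, y + f xs)"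
  by (simp add: oracle_map_def)

text \<open>Only one basis label is sent to a given label. For \<open>f\<close> constantly 0 this is
  the expansion of a state in kets.\<close>

lemma sum_ket_eq_oracle_map:
  assumes "\<And>b. b \<notin> basis k n \<Longrightarrow> \<Psi> b = 0"
  shows "(\<lambda>b. \<Sum>(xs, y)\<in>basis k n. \<Psi> (xs, y) * ket (xs, y + f xs) b) = oracle_map f \<Psi>"
proof
  fix b :: label
  obtain zs z where b: "b = (zs, z)" by (cases b)
  have *: "zs = xs \<and> z = y + f xs \<longleftrightarrow> xs = zs \<and> y = z + f zs" for xs y
    by auto
  have "(\<Sum>(xs, y)\<in>basis k n. \<Psi> (xs, y) * ket (xs, y + f xs) b)
      = (\<Sum>a\<in>basis k n. if a = (zs, z + f zs) then \<Psi> a else 0)"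
    by (intro sum.cong) (auto simp: b ket_def *)
  also have "\<dots> = oracle_map f \<Psi> b"
    using assms[of "(zs, z + f zs)"] by (auto simp: b)
  finally show "(\<Sum>(xs, y)\<in>basis k n. \<Psi> (xs, y) * ket (xs, y + f xs) b) = oracle_map f \<Psi> b" .
qed

lemma is_state_oracle_map:
  assumes "is_state k n \<Psi>"
  shows "is_state k n (oracle_map f \<Psi>)"
proof -
  \<comment> \<open>This permutation of the basis is its own inverse, so it is both witnesses of the
    reindexing.\<close>
  let ?h = "\<lambda>(xs, y). (xs, y + f xs)"
  have "(\<Sum>b\<in>basis k n. (cmod (oracle_map f \<Psi> b))\<^sup>2) = (\<Sum>b\<in>basis k n. (cmod (\<Psi> b))\<^sup>2)"
    by (rule sum.reindex_bij_witness[of _ ?h ?h]) auto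
  with assms show ?thesis
    by (auto simp: is_state_def)
qed

lemma control_comp_value_oracle_map:
  assumes "j < k" "control_comp_value k n \<Psi> j x"
  shows "control_comp_value k n (oracle_map f \<Psi>) j x"
  using assms by (simp add: control_comp_value_iff is_state_oracle_map)

text \<open>Away from \<open>x\<close> some control value is wrong and the amplitude vanishes; at
  \<open>x\<close> the target condition is shifted by the constant \<open>f x\<close>.\<close>

lemma target_comp_value_oracle_map:
  assumes x: "x \<in> tuples k n"
    and controls: "\<And>i. i < k \<Longrightarrow> control_comp_value k n \<Psi> i (x ! i)"
    and target: "target_comp_value k n \<Psi> y"
  shows "target_comp_value k n (oracle_map f \<Psi>) (y + f x)"
proof -
  have "\<Psi> (xs, y' + f xs) = 0" if xs: "xs \<in> tuples k n" and "y' \<noteq> y + f x" for xs y'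
  proof (cases "xs = x")
    case True
    with that have "y' + f xs \<noteq> y" by auto
    with target xs show ?thesis
      by (simp add: target_comp_value_iff)
  next
    case False
    with xs x obtain i where "i < k" "xs ! i \<noteq> x ! i"
      by (auto simp: tuples_def list_eq_iff_nth_eq)
    with controls[of i] xs show ?thesis
      by (simp add: control_comp_value_iff)
  qed
  with target show ?thesis
    by (simp add: target_comp_value_iff is_state_oracle_map)
qed

text \<open>Phase kickback: the sign of \<open>\<upsilon> * (y + f xs)\<close> splits, and the
  factor from \<open>f xs\<close> does not depend on \<open>y\<close>, so the control factor absorbs
  it.\<close>

lemma target_phase_value_oracle_map:
  assumes "target_phase_value k n \<Psi> \<upsilon>"
  shows "target_phase_value k n (oracle_map f \<Psi>) \<upsilon>"
proof -
  obtain \<rho> where \<rho>: "\<And>xs y. xs \<in> tuples k n \<Longrightarrow> \<Psi> (xs, y) = \<rho> xs * phase_ket [\<upsilon>] [y]"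
    using assms by (auto simp: target_phase_value_def target_in_def basis_def)
  have "\<forall>(xs, y)\<in>basis k n. oracle_map f \<Psi> (xs, y)
      = (\<rho> xs * of_real (minus_one_pow (\<upsilon> * f xs))) * phase_ket [\<upsilon>] [y]"
    by (auto simp: \<rho> phase_ket_bit distrib_left minus_one_pow_add)
  with assms show ?thesis
    by (auto simp: target_phase_value_def target_in_def is_state_oracle_map
        intro!: exI[of _ "\<lambda>xs. \<rho> xs * of_real (minus_one_pow (\<upsilon> * f xs))"])
qed

text \<open>The factorisation at register \<open>j\<close> fixes the dependence on \<open>v\<close>,
  the one at the target fixes the dependence on \<open>y\<close>. Normalisation over
  \<open>2 * 2 ^ n j\<close> amplitudes of equal modulus fixes the modulus of
  \<open>\<gamma>\<close>.\<close>

lemma slice_amplitudes: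
  assumes x: "x \<in> tuples k n" and j: "j < k" and chi: "chi \<in> bits (n j)"
    and controls: "\<And>i. i < k \<Longrightarrow> i \<noteq> j \<Longrightarrow> control_comp_value k n \<Psi> i (x ! i)"
    and phase: "control_phase_value k n \<Psi> j chi"
    and target: "target_phase_value k n \<Psi> \<upsilon>"
  obtains \<gamma> where
    "\<And>v y. v \<in> bits (n j) \<Longrightarrow>
       \<Psi> (x[j := v], y) = \<gamma> * of_real (minus_one_pow (bs_dot chi v) * minus_one_pow (\<upsilon> * y))"
    and "(cmod \<gamma>)\<^sup>2 * 2 * 2 ^ n j = 1"
proof -
  have len: "length x = k" "length chi = n j"
    using x chi by (simp_all add: tuples_def in_bits_iff)
  obtain \<rho> where \<rho>: "\<And>xs y. xs \<in> tuples k n \<Longrightarrow>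
      \<Psi> (xs, y) = phase_ket chi (xs ! j) * \<rho> (take j xs @ drop (Suc j) xs, y)"
    using phase by (auto simp: control_phase_value_def control_in_def basis_def)
  obtain \<sigma> where \<sigma>: "\<And>xs y. xs \<in> tuples k n \<Longrightarrow> \<Psi> (xs, y) = \<sigma> xs * phase_ket [\<upsilon>] [y]"
    using target by (auto simp: target_phase_value_def target_in_def basis_def)
  \<comment> \<open>The remaining registers, the same for every \<open>v\<close> in the
    slice.\<close>
  define z where "z = take j x @ drop (Suc j) x"
  \<comment> \<open>A reference point at which the two factorisations are compared; any string of
    this length would do, as phase kets vanish at none of them.\<close>
  define zeros where "zeros = replicate (n j) (0 :: bit)"
  have slice: "\<Psi> (x[j := v], y) = phase_ket chi v * \<rho> (z, y)" if "v \<in> bits (n j)" for v y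
    using \<rho>[OF tuples_update[OF x that], of y] j len by (simp add: z_def)
  have nz: "phase_ket chi zeros \<noteq> 0"
    by (simp add: phase_ket_eq len zeros_def)
  \<comment> \<open>The square roots collect the normalisations of the phase kets of register
    \<open>j\<close> and of the target.\<close>
  define \<gamma> where "\<gamma> = \<sigma> (x[j := zeros]) / (phase_ket chi zeros * of_real (sqrt 2 ^ n j * sqrt 2))"
  have amp: "\<Psi> (x[j := v], y) = \<gamma> * of_real (minus_one_pow (bs_dot chi v) * minus_one_pow (\<upsilon> * y))"
    if v: "v \<in> bits (n j)" for v y
  proof -
    have zeros: "zeros \<in> bits (n j)"
      by (simp add: zeros_def)
    have "phase_ket chi zeros * \<rho> (z, y) = \<sigma> (x[j := zeros]) * phase_ket [\<upsilon>] [y]"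
      using slice[OF zeros, of y] \<sigma>[OF tuples_update[OF x zeros], of y] by simp
    then have "\<rho> (z, y) = \<sigma> (x[j := zeros]) * phase_ket [\<upsilon>] [y] / phase_ket chi zeros"
      using nz by (simp add: field_simps)
    moreover have "length v = length chi"
      using v len by (simp add: in_bits_iff)
    ultimately show ?thesis
      using slice[OF v, of y] len by (simp add: \<gamma>_def phase_ket_eq[of v] phase_ket_bit mult_ac)
  qed
  have "1 = (\<Sum>b\<in>basis k n. (cmod (\<Psi> b))\<^sup>2)"
    using phase by (simp add: control_phase_value_def control_in_def is_state_def)
  also have "\<dots> = (\<Sum>v\<in>bits (n j). \<Sum>y\<in>UNIV. (cmod (\<Psi> (x[j := v], y)))\<^sup>2)"
    by (rule sum_basis_slice[OF x j]) (use controls in \<open>simp add: control_comp_value_iff\<close>)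
  also have "\<dots> = (\<Sum>v\<in>bits (n j). \<Sum>y\<in>(UNIV :: bit set). (cmod \<gamma>)\<^sup>2)"
    by (intro sum.cong refl) (simp add: amp norm_mult power_mult_distrib del: of_real_mult)
  also have "\<dots> = (cmod \<gamma>)\<^sup>2 * 2 * 2 ^ n j"
    by (simp add: UNIV_bit card_bits)
  finally show ?thesis
    using that[of \<gamma>] amp by simp
qed

text \<open>The inner product with the phase ket of \<open>\<omega>\<close> combines its sign with
  those of \<open>chi\<close> and of the kickback. The resulting weight is constant on the slice,
  and the slice size cancels against the normalisation of \<open>\<gamma>\<close>.\<close>

lemma read_phase_prob_oracle_map:
  assumes x: "x \<in> tuples k n" and j: "j < k" and chi: "chi \<in> bits (n j)" and \<omega>: "\<omega> \<in> bits (n j)"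
    and controls: "\<And>i. i < k \<Longrightarrow> i \<noteq> j \<Longrightarrow> control_comp_value k n \<Psi> i (x ! i)"
    and phase: "control_phase_value k n \<Psi> j chi"
    and target: "target_phase_value k n \<Psi> \<upsilon>"
  shows "read_phase_prob k n (oracle_map f \<Psi>) j \<omega>
    = ((\<Sum>v\<in>bits (n j). minus_one_pow (bs_dot (chi \<oplus>\<^sub>b \<omega>) v) * minus_one_pow (\<upsilon> * f (x[j := v])))
        / 2 ^ n j)\<^sup>2"
proof -
  obtain \<gamma> where amp: "\<And>v y. v \<in> bits (n j) \<Longrightarrow>
       \<Psi> (x[j := v], y) = \<gamma> * of_real (minus_one_pow (bs_dot chi v) * minus_one_pow (\<upsilon> * y))"
    and \<gamma>: "(cmod \<gamma>)\<^sup>2 * 2 * 2 ^ n j = 1"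
    using slice_amplitudes[OF x j chi controls phase target] by blast
  have len: "length x = k" "length chi = n j" "length \<omega> = n j"
    using x chi \<omega> by (simp_all add: tuples_def in_bits_iff)
  let ?P = "control_project n j (phase_ket \<omega>) (oracle_map f \<Psi>)"
  \<comment> \<open>The unnormalised Hadamard transform of the kickback sign at frequency
    \<open>chi \<oplus>\<^sub>b \<omega>\<close>.\<close>
  define S where
    "S = (\<Sum>v\<in>bits (n j). minus_one_pow (bs_dot (chi \<oplus>\<^sub>b \<omega>) v) * minus_one_pow (\<upsilon> * f (x[j := v])))"
  \<comment> \<open>Both \<open>u\<close> and \<open>y\<close> enter the projected amplitude only
    through signs, so its modulus does not depend on them.\<close>
  have P: "(cmod (?P (x[j := u], y)))\<^sup>2 = (cmod \<gamma>)\<^sup>2 * S\<^sup>2 / (2 ^ n j)\<^sup>2" if u: "u \<in> bits (n j)" for u y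
  proof -
    have "(\<Sum>v\<in>bits (n j). cnj (phase_ket \<omega> v) * \<Psi> (x[j := v], y + f (x[j := v])))
        = (\<Sum>v\<in>bits (n j). \<gamma> * of_real (minus_one_pow (\<upsilon> * y) / sqrt 2 ^ n j) * of_real
            (minus_one_pow (bs_dot (chi \<oplus>\<^sub>b \<omega>) v) * minus_one_pow (\<upsilon> * f (x[j := v]))))"
    proof (intro sum.cong refl)
      fix v assume v: "v \<in> bits (n j)"
      then have "length v = n j"
        by (simp add: in_bits_iff)
      with v len show "cnj (phase_ket \<omega> v) * \<Psi> (x[j := v], y + f (x[j := v]))
        = \<gamma> * of_real (minus_one_pow (\<upsilon> * y) / sqrt 2 ^ n j) * of_real
            (minus_one_pow (bs_dot (chi \<oplus>\<^sub>b \<omega>) v) * minus_one_pow (\<upsilon> * f (x[j := v])))"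
        by (simp add: amp phase_ket_eq bs_dot_add_left minus_one_pow_add distrib_left mult_ac)
    qed
    also have "\<dots> = \<gamma> * of_real (minus_one_pow (\<upsilon> * y) / sqrt 2 ^ n j) * of_real S"
      by (simp add: S_def sum_distrib_left)
    finally have "?P (x[j := u], y)
        = \<gamma> * of_real (minus_one_pow (bs_dot \<omega> u) / sqrt 2 ^ n j
            * (minus_one_pow (\<upsilon> * y) / sqrt 2 ^ n j) * S)"
      using u len j by (simp add: control_project_def phase_ket_eq in_bits_iff mult_ac)
    moreover have "(sqrt 2 ^ n j)\<^sup>2 = (2 :: real) ^ n j"
      by (simp flip: power_mult add: mult.commute[of _ 2]) (simp add: power_mult)
    ultimately show ?thesis
      by (simp add: norm_mult power_mult_distrib power_divide power2_eq_square[of "2 ^ n j"]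
          del: of_real_mult of_real_divide)
  qed
  have "read_phase_prob k n (oracle_map f \<Psi>) j \<omega>
      = (\<Sum>u\<in>bits (n j). \<Sum>y\<in>UNIV. (cmod (?P (x[j := u], y)))\<^sup>2)"
    unfolding read_phase_prob_def
  proof (rule sum_basis_slice[OF x j])
    fix xs y i assume xs: "xs \<in> tuples k n" and i: "i < k" "i \<noteq> j" "xs ! i \<noteq> x ! i"
    \<comment> \<open>Projecting register \<open>j\<close> combines only labels that differ at
      \<open>j\<close>, so a wrong value at \<open>i\<close> persists. The target bit is arbitrary
      here because the oracle shifts it.\<close>
    have "\<Psi> (xs[j := v], y') = 0" if "v \<in> bits (n j)" for v y'
      using controls[of i] i tuples_update[OF xs that] by (simp add: control_comp_value_iff)
    then show "(cmod (?P (xs, y)))\<^sup>2 = 0"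
      by (simp add: control_project_def)
  qed
  also have "\<dots> = ((cmod \<gamma>)\<^sup>2 * 2 * 2 ^ n j) * (S\<^sup>2 / (2 ^ n j)\<^sup>2)"
    by (simp add: P UNIV_bit card_bits)
  finally show ?thesis
    by (simp only: \<gamma> S_def power_divide mult_1)
qed

theorem theorem3:
  fixes k :: nat and n :: "nat \<Rightarrow> nat"
    and f :: "bitstring list \<Rightarrow> bit"
    and U :: "state \<Rightarrow> state"
  assumes "k \<ge> 1"
    and "\<forall>j<k. n j \<ge> 1"
    and "\<And>c :: label \<Rightarrow> complex.
      U (\<lambda>b. \<Sum>(xs, y)\<in>basis k n. c (xs, y) * ket (xs, y) b) =
        (\<lambda>b. \<Sum>(xs, y)\<in>basis k n. c (xs, y) * ket (xs, y + f xs) b)"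
  shows "induces_cp_oracle k n U (function_cp_oracle k n f) \<and>
    (\<forall>j<k. \<forall>xs\<in>tuples k n. \<forall>t\<in>bits (n j).
       pmf (T_dist n f j xs) t =
         \<bar>of_bool (t = replicate (n j) 0) - 2 * f_hat n f j (xs[j := t])\<bar>\<^sup>2) \<and>
    (\<forall>j<k. \<forall>xs\<in>tuples k n. \<forall>t\<in>bits (n j).
       pmf (f_check n f j 1 xs) t = fourier_sample_prob n f j xs t)"
proof -
  have U: "U \<Psi> = oracle_map f \<Psi>" if "is_state k n \<Psi>" for \<Psi>
  proof -
    have supp: "\<And>b. b \<notin> basis k n \<Longrightarrow> \<Psi> b = 0"
      using that unfolding is_state_def by blast
    \<comment> \<open>The assumption describes \<open>U\<close> on ket expansions only; the
      zero-function case identifies such an expansion with the state itself.\<close>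
    have "oracle_map (\<lambda>_. 0) \<Psi> = \<Psi>"
      by (auto simp: oracle_map_def)
    then show ?thesis
      using assms(3)[of \<Psi>] sum_ket_eq_oracle_map[OF supp, where f = f]
        sum_ket_eq_oracle_map[OF supp, where f = "\<lambda>_. 0"] by simp
  qed
  have "induces_cp_oracle k n U (function_cp_oracle k n f)"
    unfolding induces_cp_oracle_def
  proof (intro allI impI, elim conjE)
    fix ps y \<upsilon> qs y' \<upsilon>' \<Psi>
    assume x: "map fst ps \<in> tuples k n" and chis: "map snd ps \<in> tuples k n"
      and F: "function_cp_oracle k n f ps (y, \<upsilon>) = (qs, (y', \<upsilon>'))"
      and \<Psi>: "is_state k n \<Psi>"
    let ?x = "map fst ps"
    have len: "length ps = k"
      using x by (simp add: tuples_def)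
    have nth: "?x ! i = fst (ps ! i)" "map snd ps ! i = snd (ps ! i)" if "i < k" for i
      using that len by simp_all
    have y': "y' = y + f ?x" and \<upsilon>': "\<upsilon>' = \<upsilon>"
      and qs: "qs = map (\<lambda>j. (?x ! j, map_pmf (\<lambda>d. map snd ps ! j \<oplus>\<^sub>b d) (f_check n f j \<upsilon> ?x))) [0..<k]"
      using F by (auto simp: function_cp_oracle_def Let_def)
    have q: "fst (qs ! i) = fst (ps ! i)"
      "snd (qs ! i) = map_pmf (\<lambda>d. snd (ps ! i) \<oplus>\<^sub>b d) (f_check n f i \<upsilon> ?x)" if "i < k" for i
      using that len by (simp_all add: qs)
    show "((\<forall>i<k. control_comp_value k n \<Psi> i (fst (ps ! i))) \<and> target_comp_value k n \<Psi> y \<longrightarrow>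
           (\<forall>i<k. control_comp_value k n (U \<Psi>) i (fst (qs ! i))) \<and>
           target_comp_value k n (U \<Psi>) y') \<and>
        (\<forall>j<k.
           (\<forall>i<k. i \<noteq> j \<longrightarrow> control_comp_value k n \<Psi> i (fst (ps ! i))) \<and>
           control_phase_value k n \<Psi> j (snd (ps ! j)) \<and> target_phase_value k n \<Psi> \<upsilon> \<longrightarrow>
           (\<forall>i<k. i \<noteq> j \<longrightarrow> control_comp_value k n (U \<Psi>) i (fst (qs ! i))) \<and>
           target_phase_value k n (U \<Psi>) \<upsilon>' \<and>
           (\<forall>\<omega>\<in>bits (n j). read_phase_prob k n (U \<Psi>) j \<omega> = pmf (snd (qs ! j)) \<omega>))"
      unfolding U[OF \<Psi>] y' \<upsilon>'
    proof (intro conjI allI impI ballI; elim conjE)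
      fix j \<omega>
      assume j: "j < k" and \<omega>: "\<omega> \<in> bits (n j)"
        and "\<forall>i<k. i \<noteq> j \<longrightarrow> control_comp_value k n \<Psi> i (fst (ps ! i))"
        and phase: "control_phase_value k n \<Psi> j (snd (ps ! j))"
        and target: "target_phase_value k n \<Psi> \<upsilon>"
      then have controls: "\<And>i. i < k \<Longrightarrow> i \<noteq> j \<Longrightarrow> control_comp_value k n \<Psi> i (?x ! i)"
        by (simp add: nth)
      have chi: "snd (ps ! j) \<in> bits (n j)"
        using chis j nth[OF j] by (auto simp: tuples_def)
      show "read_phase_prob k n (oracle_map f \<Psi>) j \<omega> = pmf (snd (qs ! j)) \<omega>"
        \<comment> \<open>Both sides have the same closed form, the squared transform of the
          kickback sign at \<open>snd (ps ! j) \<oplus>\<^sub>b \<omega>\<close>.\<close>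
        using j len unfolding q(2)[OF j]
        by (subst pmf_shifted_f_check)
          (simp_all add: chi \<omega> read_phase_prob_oracle_map[OF x j chi \<omega> controls phase target])
    qed (auto simp: q nth intro!: control_comp_value_oracle_map target_phase_value_oracle_map
        target_comp_value_oracle_map[OF x])
  qed
  moreover have "length xs = k" if "xs \<in> tuples k n" for xs
    using that by (simp add: tuples_def)
  ultimately show ?thesis
    unfolding T_prob_def[symmetric] by (simp add: f_check_1 pmf_T_dist T_prob_eq_fourier_sample_prob)
qed

end
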